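(* Let $\mathcal{S}$ be a set of stakeholders, each $s\in\mathcal{S}$ with an argumentation theory $\mathcal{N}_s=(\mathcal{L},\overline{\,\cdot\,},\mathcal{R}_s,\mathcal{K})$. Given the combined argumentation framework $AF(\mathcal{S})=(\mathit{Arg}(\mathcal{S}),\mathit{Def}(\mathcal{S}))$ and the integrated argumentation framework $AF(\mathcal{N}_\mathcal{S})=(\mathit{Arg}(\mathcal{N}_\mathcal{S}),\mathit{Def}(\mathcal{N}_\mathcal{S}))$, it holds that $\mathit{Arg}(\mathcal{S})\subseteq\mathit{Arg}(\mathcal{N}_\mathcal{S})$ and $\mathit{Def}(\mathcal{S})\subseteq\mathit{Def}(\mathcal{N}_\mathcal{S})$.
   Context: Language and norms. Fix a set $\mathit{Var}$ of propositional atoms and a language $\mathcal{L}$ with $\mathit{Var}\subseteq\mathcal{L}\subseteq \mathit{Var}\cup\{\neg p: p\in\mathit{Var}\}$. A contrariness function is a (partial) map $\overline{\,\cdot\,}:\mathcal{L}\to 2^{\mathcal{L}}$, not necessarily symmetric, with $\varphi\in\overline{\neg\varphi}$ and $\neg\varphi\in\overline{\varphi}$ for every $\neg\varphi\in\mathcal{L}$. A norm of stakeholder $s$ is an expression $\phi_1,\dots,\phi_n\Rightarrow^\tau_s\phi$ with $\phi_i,\phi\in\mathcal{L}$ and type $\tau\in\{c,r,p\}$ (constitutive, regulative, permissive). An argumentation theory of $s$ is $\mathcal{N}_s=(\mathcal{L},\overline{\,\cdot\,},\mathcal{R}_s,\mathcal{K})$ with $\mathcal{R}_s$ a set of norms of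 $s$ and $\mathcal{K}\subseteq\mathcal{L}$ (the context, or brute facts); the language, contrariness function and context are shared by all stakeholders. Arguments. Over a theory $\mathcal{N}$ with norms $\mathcal{R}$ and context $\mathcal{K}$, arguments are built inductively, with a conclusion $\mathrm{Conc}$: (1) $\{\phi\}$ for $\phi\in\mathcal{K}$ (brute fact argument), conclusion $\phi$; (2) if $A_1,\dots,A_n$ are brute or institutional fact arguments and $\mathrm{Conc}(A_1),\dots,\mathrm{Conc}(A_n)\Rightarrow^\tau_s\phi$ is a norm in $\mathcal{R}$, then $A_1,\dots,A_n\Rightarrow^\tau_s\phi$ is an argument with conclusion $\phi$, called an institutional fact argument if $\tau=c$, an obligation argument if $\tau=r$, and a permission argument if $\tau=p$. $\mathcal{A}^b,\mathcal{A}^c,\mathcal{A}^r,\mathcal{A}^p$ are the sets of brute fact, institutional fact, obligation and permission arguments. $\mathrm{Sub}(A)$ consists of $A$ and all subarguments of its immediate constituents $A_i$. $\mathit{Arg}(\mathcal{N})$ is the set of arguments built from $\mathcal{N}$. Priority and defeat. The relation $\succeq$ on a set of arguments is the one in which: $A\succeq B$ for $A,B\in\mathcal{A}^\tau$ with the same $\tau\in\{b,c,r\}$; $A\succ B$ for $A\in\mathcal{A}^b$, $B\in\mathcal{A}^c\cup\mathcal{A}^r$; $A\succ B$ for $A\in\mathcal{A}^c$, $B\in\mathcal{A}^r$; $A\succ B$ for $A\in\mathcal{A}^p$, $B\in\mathcal{A}^r$; no other pairs are related. Here $A\succ B$ means $A\succeq B$ and $B\not\succeq A$, and $B\prec A$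 means $A\succ B$. $A$ attacks $B$ at $B'$ iff $B'\in\mathrm{Sub}(B)$ and $\mathrm{Conc}(A)\in\overline{\mathrm{Conc}(B')}$. $A$ defeats $B$ iff either $A$ attacks $B$ at some $B'$ with $A\succeq B'$, or some $B'\in\mathrm{Sub}(B)$ attacks $A$ at $A$ and $B'\prec A$. $\mathit{Def}(\mathcal{N})$ is the defeat relation on $\mathit{Arg}(\mathcal{N})$. Combined framework. $\mathit{Arg}(\mathcal{S})=\bigcup_{s\in\mathcal{S}}\mathit{Arg}(\mathcal{N}_s)$, and $\mathit{Def}(\mathcal{S})$ is the defeat relation on the set $\mathit{Arg}(\mathcal{S})$. Integrated framework. $\mathcal{N}_\mathcal{S}=(\mathcal{L},\overline{\,\cdot\,},\mathcal{R}_\mathcal{S},\mathcal{K})$ with $\mathcal{R}_\mathcal{S}=\bigcup_{s\in\mathcal{S}}\mathcal{R}_s$, and $AF(\mathcal{N}_\mathcal{S})=(\mathit{Arg}(\mathcal{N}_\mathcal{S}),\mathit{Def}(\mathcal{N}_\mathcal{S}))$ (so that arguments may combine norms of different stakeholders). *)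

theory Defs
  imports Main
begin

datatype 'v lit = Atom 'v | Neg 'v

definition is_language :: "'v set \<Rightarrow> 'v lit set \<Rightarrow> bool" where
  "is_language V L \<longleftrightarrow> Atom ` V \<subseteq> L \<and> L \<subseteq> Atom ` V \<union> Neg ` V"

type_synonym 'v contrariness = "'v lit \<Rightarrow> 'v lit set option"

text \<open>\<open>contrary ctr \<phi> \<psi>\<close> reads: \<open>\<phi>\<close> belongs to the set of contraries of \<open>\<psi>\<close>. It is false
  where the partial map is undefined.\<close>

definition contrary :: "'v contrariness \<Rightarrow> 'v lit \<Rightarrow> 'v lit \<Rightarrow> bool" where
  "contrary ctr \<phi> \<psi> \<longleftrightarrow> (\<exists>C. ctr \<psi> = Some C \<and> \<phi> \<in> C)"

definition is_contrariness :: "'v lit set \<Rightarrow> 'v contrariness \<Rightarrow> bool" where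
  "is_contrariness L ctr \<longleftrightarrow>
     dom ctr \<subseteq> L \<and> ran ctr \<subseteq> Pow L \<and>
     (\<forall>p. Neg p \<in> L \<longrightarrow> contrary ctr (Atom p) (Neg p) \<and> contrary ctr (Neg p) (Atom p))"

datatype norm_type = Constitutive | Regulative | Permissive

text \<open>Norms with an empty body are admitted; a theory may exclude them by its choice of norms.\<close>

datatype ('s, 'v) norm =
  Norm (body: "'v lit list") (ntype: norm_type) (owner: 's) (head: "'v lit")

record ('s, 'v) arg_theory =
  lang :: "'v lit set"
  contr :: "'v contrariness"
  norms :: "('s, 'v) norm set"
  context_of :: "'v lit set"

definition argumentation_theory_of :: "'v set \<Rightarrow> 's \<Rightarrow> ('s, 'v) arg_theory \<Rightarrow> bool" where
  "argumentation_theory_of V s T \<longleftrightarrow>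
     is_language V (lang T) \<and>
     is_contrariness (lang T) (contr T) \<and>
     (\<forall>n \<in> norms T. owner n = s \<and> set (body n) \<subseteq> lang T \<and> head n \<in> lang T) \<and>
     context_of T \<subseteq> lang T"

datatype ('s, 'v) arg =
    Brute "'v lit"
  | Step "('s, 'v) arg list" norm_type 's "'v lit"

fun conc :: "('s, 'v) arg \<Rightarrow> 'v lit" where
  "conc (Brute \<phi>) = \<phi>"
| "conc (Step As \<tau> s \<phi>) = \<phi>"

fun Sub :: "('s, 'v) arg \<Rightarrow> ('s, 'v) arg set" where
  "Sub (Brute \<phi>) = {Brute \<phi>}"
| "Sub (Step As \<tau> s \<phi>) = insert (Step As \<tau> s \<phi>) (\<Union>A \<in> set As. Sub A)"

datatype arg_kind = BruteFact | InstFact | Obligation | Permission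

fun kind_of_type :: "norm_type \<Rightarrow> arg_kind" where
  "kind_of_type Constitutive = InstFact"
| "kind_of_type Regulative = Obligation"
| "kind_of_type Permissive = Permission"

fun kind :: "('s, 'v) arg \<Rightarrow> arg_kind" where
  "kind (Brute \<phi>) = BruteFact"
| "kind (Step As \<tau> s \<phi>) = kind_of_type \<tau>"

inductive_set Arg :: "('s, 'v) arg_theory \<Rightarrow> ('s, 'v) arg set" for T where
  brute: "\<phi> \<in> context_of T \<Longrightarrow> Brute \<phi> \<in> Arg T"
| step: "\<lbrakk>\<forall>A \<in> set As. A \<in> Arg T \<and> kind A \<in> {BruteFact, InstFact};
          Norm (map conc As) \<tau> s \<phi> \<in> norms T\<rbrakk> \<Longrightarrow> Step As \<tau> s \<phi> \<in> Arg T"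

text \<open>\<open>prior X A B\<close> is \<open>A \<succeq> B\<close> on the set of arguments \<open>X\<close>. Permission arguments are
  not even related to themselves.\<close>

definition kind_prior :: "(arg_kind \<times> arg_kind) set" where
  "kind_prior =
     {(BruteFact, BruteFact), (InstFact, InstFact), (Obligation, Obligation),
      (BruteFact, InstFact), (BruteFact, Obligation), (InstFact, Obligation),
      (Permission, Obligation)}"

definition prior :: "('s, 'v) arg set \<Rightarrow> ('s, 'v) arg \<Rightarrow> ('s, 'v) arg \<Rightarrow> bool" where
  "prior X A B \<longleftrightarrow> A \<in> X \<and> B \<in> X \<and> (kind A, kind B) \<in> kind_prior"

definition strictly_prior :: "('s, 'v) arg set \<Rightarrow> ('s, 'v) arg \<Rightarrow> ('s, 'v) arg \<Rightarrow> bool" where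
  "strictly_prior X A B \<longleftrightarrow> prior X A B \<and> \<not> prior X B A"

lemma strictly_prior_iff:
  "strictly_prior X A B \<longleftrightarrow> A \<in> X \<and> B \<in> X \<and>
     (kind A = BruteFact \<and> kind B \<in> {InstFact, Obligation} \<or>
      kind A = InstFact \<and> kind B = Obligation \<or>
      kind A = Permission \<and> kind B = Obligation)"
  by (auto simp: strictly_prior_def prior_def kind_prior_def)

definition attacks_at ::
  "'v contrariness \<Rightarrow> ('s, 'v) arg \<Rightarrow> ('s, 'v) arg \<Rightarrow> ('s, 'v) arg \<Rightarrow> bool" where
  "attacks_at ctr A B B' \<longleftrightarrow> B' \<in> Sub B \<and> contrary ctr (conc A) (conc B')"

definition defeats ::
  "'v contrariness \<Rightarrow> ('s, 'v) arg set \<Rightarrow> ('s, 'v) arg \<Rightarrow> ('s, 'v) arg \<Rightarrow> bool" where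
  "defeats ctr X A B \<longleftrightarrow>
     (\<exists>B'. attacks_at ctr A B B' \<and> prior X A B') \<or>
     (\<exists>B' \<in> Sub B. attacks_at ctr B' A A \<and> strictly_prior X A B')"

definition Def_on ::
  "'v contrariness \<Rightarrow> ('s, 'v) arg set \<Rightarrow> (('s, 'v) arg \<times> ('s, 'v) arg) set" where
  "Def_on ctr X = {(A, B). A \<in> X \<and> B \<in> X \<and> defeats ctr X A B}"

record ('s, 'v) arg_framework =
  arguments :: "('s, 'v) arg set"
  defeat :: "(('s, 'v) arg \<times> ('s, 'v) arg) set"

definition AF :: "('s, 'v) arg_theory \<Rightarrow> ('s, 'v) arg_framework" where
  "AF T = \<lparr>arguments = Arg T, defeat = Def_on (contr T) (Arg T)\<rparr>"

text \<open>The first parameter of \<open>combined_AF\<close> is the contrariness function shared by all the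
  theories \<open>N s\<close>.\<close>

definition combined_AF ::
  "'v contrariness \<Rightarrow> 's set \<Rightarrow> ('s \<Rightarrow> ('s, 'v) arg_theory) \<Rightarrow> ('s, 'v) arg_framework" where
  "combined_AF ctr S N =
     \<lparr>arguments = (\<Union>s \<in> S. Arg (N s)), defeat = Def_on ctr (\<Union>s \<in> S. Arg (N s))\<rparr>"

definition integrated_theory ::
  "'v lit set \<Rightarrow> 'v contrariness \<Rightarrow> ('s \<Rightarrow> ('s, 'v) norm set) \<Rightarrow> 'v lit set \<Rightarrow> 's set
    \<Rightarrow> ('s, 'v) arg_theory" where
  "integrated_theory L ctr R K S =
     \<lparr>lang = L, contr = ctr, norms = (\<Union>s \<in> S. R s), context_of = K\<rparr>"

end

theory Submission
  imports Defs
begin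

text \<open>Enlarging the norms keeps every argument, since the construction rules are monotone in them.
  Priority depends on the ambient set of arguments only through membership; strict priority does
  so too, because its negated conjunct is evaluated only for two members. Hence enlarging the
  set of arguments keeps every defeat.\<close>

lemma Arg_mono:
  assumes "context_of T \<subseteq> context_of T'" and "norms T \<subseteq> norms T'"
  shows "Arg T \<subseteq> Arg T'"
proof
  fix A
  assume "A \<in> Arg T"
  then show "A \<in> Arg T'"
  proof induction
    case (brute \<phi>)
    then show ?case
      using assms(1) by (auto intro: Arg.brute)
  next
    case (step As \<tau> s \<phi>)
    then show ?case
      \<comment> \<open>\<open>kind\<close> and \<open>conc\<close> do not refer to the theory, so
        the side condition and the norm required stay the same.\<close>
      using assms(2) by (intro Arg.step) auto
  qed
qed

lemma prior_mono: "X \<subseteq> Y \<Longrightarrow> prior X A B \<Longrightarrow> prior Y A B"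
  by (auto simp: prior_def)

lemma strictly_prior_mono: "X \<subseteq> Y \<Longrightarrow> strictly_prior X A B \<Longrightarrow> strictly_prior Y A B"
  by (auto simp: strictly_prior_def prior_def)

text \<open>The same witness \<open>B'\<close> serves for \<open>Y\<close>: attacks do not depend on
  the ambient set, and priority over \<open>X\<close> already places \<open>B'\<close> in
  \<open>X\<close>.\<close>

lemma defeats_mono: "X \<subseteq> Y \<Longrightarrow> defeats ctr X A B \<Longrightarrow> defeats ctr Y A B"
  unfolding defeats_def by (blast intro: prior_mono strictly_prior_mono)

lemma Def_on_mono: "X \<subseteq> Y \<Longrightarrow> Def_on ctr X \<subseteq> Def_on ctr Y"
  unfolding Def_on_def by (blast intro: defeats_mono)

theorem fact5p5:
  fixes Var :: "'v set"
    and L :: "'v lit set"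
    and ctr :: "'v contrariness"
    and K :: "'v lit set"
    and S :: "'s set"
    and R :: "'s \<Rightarrow> ('s, 'v) norm set"
    and N :: "'s \<Rightarrow> ('s, 'v) arg_theory"
  assumes "\<And>s. s \<in> S \<Longrightarrow> N s = \<lparr>lang = L, contr = ctr, norms = R s, context_of = K\<rparr>"
    and "\<And>s. s \<in> S \<Longrightarrow> argumentation_theory_of Var s (N s)"
  shows "arguments (combined_AF ctr S N) \<subseteq> arguments (AF (integrated_theory L ctr R K S)) \<and>
         defeat (combined_AF ctr S N) \<subseteq> defeat (AF (integrated_theory L ctr R K S))"
proof -
  let ?T = "integrated_theory L ctr R K S"
  have "Arg (N s) \<subseteq> Arg ?T" if "s \<in> S" for s
    using that by (intro Arg_mono) (auto simp: assms(1) integrated_theory_def)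
  then have args: "(\<Union>s \<in> S. Arg (N s)) \<subseteq> Arg ?T"
    by blast
  \<comment> \<open>\<open>Def_on_mono\<close> keeps the contrariness fixed, so both defeat
    relations must be seen to use \<open>ctr\<close>.\<close>
  moreover have "contr ?T = ctr"
    by (simp add: integrated_theory_def)
  ultimately show ?thesis
    using Def_on_mono[OF args] by (simp add: combined_AF_def AF_def)
qed

end
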